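(* For every integer $d\ge 1$, every $d$-dimensional real inner-product space $V$, every full-rank lattice $\mathcal L\subset V$, every $\boldsymbol\alpha\in V$, and every integer $N\ge 2$, $$ g_N(\boldsymbol\alpha,\mathcal L)\le 2^d+1. $$
   Context: Let $V$ be a $d$-dimensional real inner-product space with induced norm $\|\cdot\|$, $\mathcal L\subset V$ a full-rank lattice (a discrete subgroup spanning $V$), and $\boldsymbol\alpha\in V$. For integers $N\ge 2$ and $1\le n\le N$, set $$\delta_{n,N}=\min\{\|(m-n)\boldsymbol\alpha+\ell\| : m\in\mathbb Z,\ 1\le m\le N,\ \ell\in\mathcal L,\ (m-n)\boldsymbol\alpha+\ell\neq 0\}.$$ (The choice $m=n$ is allowed, in which case $\ell$ is a nonzero lattice vector.) Define $g_N(\boldsymbol\alpha,\mathcal L)=\#\{\delta_{n,N}:1\le n\le N\}$, the number of distinct values among $\delta_{1,N},\dots,\delta_{N,N}$. *)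

theory Defs
  imports "HOL-Analysis.Analysis"
begin

definition full_rank_lattice :: "'a::euclidean_space set \<Rightarrow> bool" where
  "full_rank_lattice L \<longleftrightarrow>
     0 \<in> L \<and> (\<forall>x\<in>L. \<forall>y\<in>L. x + y \<in> L) \<and> (\<forall>x\<in>L. - x \<in> L) \<and>
     discrete L \<and> span L = UNIV"

(* LEAST is the minimum of a set of reals whenever it is attained; for a full-rank lattice L
   it is, since L has finitely many points in each ball and contains a nonzero vector
   (take m = n).  For other L the value may be unspecified. *)
definition delta :: "'a::euclidean_space \<Rightarrow> 'a set \<Rightarrow> int \<Rightarrow> int \<Rightarrow> real" where
  "delta \<alpha> L N n =
     (LEAST r. r \<in> {norm (of_int (m - n) *\<^sub>R \<alpha> + l) | m l.
        1 \<le> m \<and> m \<le> N \<and> l \<in> L \<and> of_int (m - n) *\<^sub>R \<alpha> + l \<noteq> 0})"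

definition gap_count :: "'a::euclidean_space \<Rightarrow> 'a set \<Rightarrow> int \<Rightarrow> nat" where
  "gap_count \<alpha> L N = card {delta \<alpha> L N n | n. 1 \<le> n \<and> n \<le> N}"

end

theory Submission
  imports Defs
begin

text \<open>By symmetry, \<open>\<delta>\<close> at \<open>n\<close> depends only on \<open>max (n - 1) (N - n)\<close>: it is the least nonzero norm
  of a vector of height at most this bound in the group \<open>G\<close> of pairs \<open>(k \<alpha> + l, k)\<close>.  So all values
  but one come from records \<open>x\<^sub>k \<in> G\<close>, of heights \<open>k\<close> in \<open>{M<..2 * M}\<close> with \<open>M = N div 2\<close>.  If \<open>x\<close>
  or \<open>x - y\<close> lay in \<open>2 G\<close>, its half would be too short for its height; if \<open>a + b + c\<close> did, the same
  would hold for half of \<open>a + b - c\<close>, \<open>a - b + c\<close> or \<open>b + c - a\<close> (because together with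
  \<open>a + b + c\<close> their squared norms add up to \<open>4 (|a|^2 + |b|^2 + |c|^2)\<close>).  So modulo \<open>2 G\<close> the records are nonzero, distinct, and no three distinct ones
  sum to zero.  Hence for a record \<open>s\<close> the set \<open>S\<close> of records and its translate by \<open>s\<close> have disjoint
  images in \<open>G / 2 G\<close>, which has at most \<open>2 ^ (d + 1)\<close> elements.\<close>

section \<open>Packing in separated groups and counting residues modulo doubles\<close>

locale separated_group =
  fixes G :: "'e::euclidean_space set" and e :: real
  assumes zero: "0 \<in> G"
    and add: "x \<in> G \<Longrightarrow> y \<in> G \<Longrightarrow> x + y \<in> G"
    and uminus: "x \<in> G \<Longrightarrow> - x \<in> G"
    and pos: "0 < e"
    and sep: "x \<in> G \<Longrightarrow> x \<noteq> 0 \<Longrightarrow> e \<le> norm x"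
begin

lemma diff: "x \<in> G \<Longrightarrow> y \<in> G \<Longrightarrow> x - y \<in> G"
  using add[of x "- y"] uminus[of y] by simp

text \<open>Volume comparison: the balls of radius \<open>e / 2\<close> around the points of
  \<open>F\<close> are disjoint and lie in the ball of radius \<open>R + e / 2\<close> around the
  origin. Both sides are then scaled by \<open>2 ^ DIM('e)\<close>.\<close>

lemma packing_bound:
  assumes F: "F \<subseteq> G" "finite F" and R: "0 \<le> R" "\<And>x. x \<in> F \<Longrightarrow> norm x \<le> R"
  shows "real (card F) * e ^ DIM('e) \<le> (2 * R + e) ^ DIM('e)"
proof -
  let ?d = "DIM('e)" and ?v = "unit_ball_vol (real DIM('e))"
  have disj: "disjoint_family_on (\<lambda>x. ball x (e / 2)) F"
    unfolding disjoint_family_on_def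
  proof (intro ballI impI)
    fix x y assume xy: "x \<in> F" "y \<in> F" "x \<noteq> y"
    then have "e \<le> dist x y"
      using sep[of "x - y"] diff[of x y] F by (auto simp: dist_norm)
    then show "ball x (e / 2) \<inter> ball y (e / 2) = {}"
      by (intro disjoint_ballI) simp
  qed
  have "real (card F) * (?v * (e / 2) ^ ?d) = (\<Sum>x\<in>F. measure lebesgue (ball x (e / 2)))"
    using pos by (simp add: content_ball)
  also have "\<dots> = measure lebesgue (\<Union>x\<in>F. ball x (e / 2))"
    using F disj
    by (intro measure_finite_Union[symmetric])
       (auto simp: emeasure_lborel_ball_finite[THEN less_imp_neq, unfolded infinity_ennreal_def])
  also have "\<dots> \<le> measure lebesgue (ball (0::'e) (R + e / 2))"
  proof (rule measure_mono_fmeasurable)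
    show "(\<Union>x\<in>F. ball x (e / 2)) \<subseteq> ball 0 (R + e / 2)"
    proof clarify
      fix x y assume "x \<in> F" "y \<in> ball x (e / 2)"
      then have "norm x \<le> R" "norm (y - x) < e / 2"
        using R by (auto simp: dist_norm norm_minus_commute)
      then show "y \<in> ball 0 (R + e / 2)"
        using norm_triangle_ineq[of x "y - x"] by simp
    qed
  qed (use F in auto)
  also have "\<dots> = ?v * (R + e / 2) ^ ?d"
    using pos R by (simp add: content_ball)
  finally have "?v * (real (card F) * (e / 2) ^ ?d) \<le> ?v * (R + e / 2) ^ ?d"
    by (simp add: algebra_simps)
  then have "real (card F) * (e / 2) ^ ?d \<le> (R + e / 2) ^ ?d"
    by (simp add: mult_le_cancel_left_pos)
  then have "2 ^ ?d * (real (card F) * (e / 2) ^ ?d) \<le> 2 ^ ?d * (R + e / 2) ^ ?d"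
    by simp
  moreover have "2 ^ ?d * (R + e / 2) ^ ?d = (2 * R + e) ^ ?d"
    by (simp add: power_mult_distrib[symmetric] algebra_simps)
  moreover have "2 ^ ?d * (real (card F) * (e / 2) ^ ?d) = real (card F) * e ^ ?d"
    by (simp add: power_divide)
  ultimately show ?thesis by simp
qed

lemma finite_bounded: "finite {x \<in> G. norm x \<le> R}"
proof (cases "R < 0")
  case True
  then have "\<not> norm x \<le> R" for x :: 'e using norm_ge_zero[of x] by linarith
  then show ?thesis by simp
next
  case False
  obtain n :: nat where n: "(2 * R + e) ^ DIM('e) / e ^ DIM('e) \<le> real n"
    using real_arch_simple by blast
  have "finite {x \<in> G. norm x \<le> R} \<and> card {x \<in> G. norm x \<le> R} \<le> n"
  proof (rule finite_if_finite_subsets_card_bdd)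
    fix F assume "F \<subseteq> {x \<in> G. norm x \<le> R}" "finite F"
    then have "real (card F) * e ^ DIM('e) \<le> (2 * R + e) ^ DIM('e)"
      using False by (intro packing_bound) auto
    then have "real (card F) \<le> (2 * R + e) ^ DIM('e) / e ^ DIM('e)"
      using pos by (simp add: field_simps)
    with n show "card F \<le> n" by linarith
  qed
  then show ?thesis by blast
qed

text \<open>If \<open>T\<close> has \<open>m\<close> elements, the sums \<open>t\<^sub>0 + 2 t\<^sub>1 + \<dots> + 2^(j-1) t\<^sub>j\<^sub>-\<^sub>1\<close> are \<open>m ^ j\<close> distinct
  points of norm \<open>O(2 ^ j)\<close>; compare with the packing bound as \<open>j\<close> grows.\<close>

lemma card_incongruent_mod_2:
  assumes T: "T \<subseteq> G" "finite T"
    and inc: "\<And>s t w. s \<in> T \<Longrightarrow> t \<in> T \<Longrightarrow> w \<in> G \<Longrightarrow> s - t = 2 *\<^sub>R w \<Longrightarrow> s = t"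
  shows "card T \<le> 2 ^ DIM('e)"
proof (rule ccontr)
  assume "\<not> card T \<le> 2 ^ DIM('e)"
  then have big: "real (card T) > 2 ^ DIM('e)"
    by (metis not_le of_nat_less_iff of_nat_numeral of_nat_power)
  define C where "C = (\<Sum>t\<in>T. norm t)"
  have C: "norm t \<le> C" if "t \<in> T" for t
    using T that by (auto simp: C_def intro: member_le_sum)
  have C0: "0 \<le> C" by (simp add: C_def sum_nonneg)
  define W where "W = rec_nat {0} (\<lambda>_ W. (\<lambda>(t, w). t + 2 *\<^sub>R w) ` (T \<times> W))"
  have W0: "W 0 = {0}" and WS: "W (Suc j) = (\<lambda>(t, w). t + 2 *\<^sub>R w) ` (T \<times> W j)" for j
    by (simp_all add: W_def)
  \<comment> \<open>The factor \<open>2 ^ j - 1\<close> is \<open>1 + 2 + ... + 2 ^ (j - 1)\<close>,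
    the total weight of the digits. Incongruence makes the lowest digit, and hence inductively every
    digit, recoverable from the sum.\<close>
  have W: "W j \<subseteq> G \<and> finite (W j) \<and> card (W j) = card T ^ j \<and> (\<forall>w\<in>W j. norm w \<le> (2 ^ j - 1) * C)"
    for j
  proof (induction j)
    case 0
    then show ?case by (simp add: W0 zero)
  next
    case (Suc j)
    have inj: "inj_on (\<lambda>(t, w). t + 2 *\<^sub>R w) (T \<times> W j)"
    proof (intro inj_onI, clarify)
      fix s v t w assume *: "s \<in> T" "v \<in> W j" "t \<in> T" "w \<in> W j" "s + 2 *\<^sub>R v = t + 2 *\<^sub>R w"
      then have "s - t = 2 *\<^sub>R (w - v)" by (simp add: algebra_simps)
      moreover have "w - v \<in> G" using * Suc by (blast intro: diff)
      ultimately have "s = t" using inc * by blast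
      then show "s = t \<and> v = w" using * by simp
    qed
    have "W (Suc j) \<subseteq> G"
    proof
      fix x assume "x \<in> W (Suc j)"
      then obtain t w where "t \<in> T" "w \<in> W j" "x = t + (w + w)"
        by (auto simp: WS scaleR_2)
      then show "x \<in> G" using T Suc by (blast intro: add)
    qed
    moreover have "norm x \<le> (2 ^ Suc j - 1) * C" if x: "x \<in> W (Suc j)" for x
    proof -
      obtain t w where tw: "t \<in> T" "w \<in> W j" "x = t + 2 *\<^sub>R w"
        using x by (auto simp: WS)
      have "norm x \<le> norm t + 2 * norm w"
        using norm_triangle_ineq[of t "2 *\<^sub>R w"] tw by simp
      also have "\<dots> \<le> C + 2 * ((2 ^ j - 1) * C)"
        using C tw Suc by (intro add_mono mult_left_mono) auto
      finally show ?thesis by (simp add: algebra_simps)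
    qed
    ultimately show ?case
      using Suc T inj by (simp add: WS card_image card_cartesian_product)
  qed
  \<comment> \<open>Growing the radius by \<open>2 ^ j\<close> costs only \<open>2 ^ DIM('e)\<close>
    per digit, while each digit multiplies the number of points by \<open>card T\<close>. The
    quotient \<open>q\<close> exceeds 1, so \<open>q ^ j\<close> outgrows the constant left by the
    packing bound.\<close>
  define q where "q = real (card T) / 2 ^ DIM('e)"
  have "q > 1" using big by (simp add: q_def)
  then obtain j where j: "((2 * C + e) / e) ^ DIM('e) < q ^ j"
    using real_arch_pow by blast
  have "real (card T) ^ j * e ^ DIM('e) \<le> (2 * (2 ^ j * C) + e) ^ DIM('e)"
    using packing_bound[of "W j" "2 ^ j * C"] W[of j] C0 by (force simp: algebra_simps)
  also have "\<dots> \<le> (2 ^ j * (2 * C + e)) ^ DIM('e)"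
    using C0 pos by (intro power_mono) (auto simp: algebra_simps)
  also have "\<dots> = (2 ^ DIM('e)) ^ j * (2 * C + e) ^ DIM('e)"
    by (simp add: power_mult_distrib mult.commute flip: power_mult)
  finally have "q ^ j \<le> ((2 * C + e) / e) ^ DIM('e)"
    using pos by (simp add: q_def power_divide divide_simps mult.commute)
  with j show False by simp
qed

text \<open>Fix \<open>s\<close> in \<open>S\<close>. Modulo doubles \<open>S\<close> and its
  translate by \<open>s\<close> are disjoint: signs do not matter there, so a congruence between
  \<open>a\<close> and \<open>b + s\<close> makes \<open>a + b + s\<close> a double. This
  contradicts \<open>triple\<close> if the three are distinct; otherwise two equal terms cancel and
  \<open>single\<close> applies to the third.\<close>

lemma card_sum_free_mod_2:
  assumes S: "S \<subseteq> G" "finite S"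
    and single: "\<And>a w. a \<in> S \<Longrightarrow> w \<in> G \<Longrightarrow> a \<noteq> 2 *\<^sub>R w"
    and pair: "\<And>a b w. a \<in> S \<Longrightarrow> b \<in> S \<Longrightarrow> a \<noteq> b \<Longrightarrow> w \<in> G \<Longrightarrow> a - b \<noteq> 2 *\<^sub>R w"
    and triple: "\<And>a b c w. a \<in> S \<Longrightarrow> b \<in> S \<Longrightarrow> c \<in> S \<Longrightarrow> a \<noteq> b \<Longrightarrow> a \<noteq> c \<Longrightarrow> b \<noteq> c \<Longrightarrow> w \<in> G \<Longrightarrow>
      a + b + c \<noteq> 2 *\<^sub>R w"
  shows "2 * card S \<le> 2 ^ DIM('e)"
proof (cases "S = {}")
  case False
  then obtain s where s: "s \<in> S" by blast
  have mixed: False if "a \<in> S" "b \<in> S" "w \<in> G" and eq: "a - (b + s) = 2 *\<^sub>R w" for a b w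
  proof -
    have G: "a \<in> G" "b \<in> G" "s \<in> G" using that s S by auto
    consider "a = b" | "a = s" | "b = s" | "a \<noteq> b" "a \<noteq> s" "b \<noteq> s" by blast
    then show False
    proof cases
      case 1
      then have "s = 2 *\<^sub>R (- w)" by (simp flip: eq)
      then show False using single s uminus that by blast
    next
      case 2
      then have "b = 2 *\<^sub>R (- w)" by (simp flip: eq)
      then show False using single uminus that by blast
    next
      case 3
      then have "a = 2 *\<^sub>R (w + s)" using eq by (simp add: algebra_simps scaleR_2)
      then show False using single G add that by blast
    next
      case 4
      have "a + b + s = 2 *\<^sub>R (w + (b + s))" using eq by (simp add: algebra_simps scaleR_2)
      then show False using triple[OF \<open>a \<in> S\<close> \<open>b \<in> S\<close> s 4] G add that by blast
    qed
  qed
  \<comment> \<open>Equality is the congruence with \<open>w = 0\<close>.\<close>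
  have disj: "S \<inter> (\<lambda>x. x + s) ` S = {}"
    using mixed[OF _ _ zero] by force
  have "card (S \<union> (\<lambda>x. x + s) ` S) \<le> 2 ^ DIM('e)"
  proof (rule card_incongruent_mod_2)
    show "S \<union> (\<lambda>x. x + s) ` S \<subseteq> G" using S s add by blast
    fix x y w assume xy: "x \<in> S \<union> (\<lambda>x. x + s) ` S" "y \<in> S \<union> (\<lambda>x. x + s) ` S"
      and w: "w \<in> G" and eq: "x - y = 2 *\<^sub>R w"
    have eq': "y - x = 2 *\<^sub>R (- w)" by (simp flip: eq)
    consider "x \<in> S" "y \<in> S" | b where "x \<in> S" "b \<in> S" "y = b + s"
      | a where "a \<in> S" "x = a + s" "y \<in> S" | a b where "a \<in> S" "x = a + s" "b \<in> S" "y = b + s"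
      using xy by blast
    then show "x = y"
    proof cases
      case 1
      then show ?thesis using pair w eq by blast
    next
      case 2
      then show ?thesis using mixed w eq by blast
    next
      case 3
      then show ?thesis using mixed uminus[OF w] eq' by blast
    next
      case 4
      then have "a - b = 2 *\<^sub>R w" using eq by simp
      then show ?thesis using 4 pair w by blast
    qed
  qed (use S in auto)
  moreover have "card (S \<union> (\<lambda>x. x + s) ` S) = 2 * card S"
    using S disj by (simp add: card_Un_disjoint card_image)
  ultimately show ?thesis by simp
qed simp

end

section \<open>Records and their congruences modulo doubles\<close>

lemma sum_of_sign_changes_norm:
  fixes a b c :: "'a::real_inner"
  shows "(norm (a + b - c))\<^sup>2 + (norm (a - b + c))\<^sup>2 + (norm (b + c - a))\<^sup>2 + (norm (a + b + c))\<^sup>2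
    = 4 * ((norm a)\<^sup>2 + (norm b)\<^sup>2 + (norm c)\<^sup>2)"
  \<comment> \<open>Each mixed inner product occurs twice with a plus sign and twice with a minus
    sign.\<close>
  by (simp add: power2_norm_eq_inner inner_commute algebra_simps inner_add_left inner_diff_left
      inner_add_right inner_diff_right)

text \<open>The window from \<open>M\<close> to \<open>2 * M\<close> guarantees that any two heights
  in it add up to more than a third, and differ by less than any of them. Heights are real so that
  the pairs live in a Euclidean space.\<close>

definition record_in :: "('a::real_normed_vector \<times> real) set \<Rightarrow> real \<Rightarrow> 'a \<times> real \<Rightarrow> bool" where
  "record_in G M x \<longleftrightarrow> x \<in> G \<and> fst x \<noteq> 0 \<and> M < snd x \<and> snd x \<le> 2 * M \<and>
     (\<forall>y\<in>G. fst y \<noteq> 0 \<longrightarrow> \<bar>snd y\<bar> < snd x \<longrightarrow> norm (fst x) < norm (fst y))"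

locale separated_product_group = separated_group G e
  for G :: "('a::euclidean_space \<times> real) set" and e :: real
begin

lemma record_in_less:
  assumes "record_in G M x" "y \<in> G" "fst y \<noteq> 0" "\<bar>snd y\<bar> < snd x"
  shows "norm (fst x) < norm (fst y)"
  using assms by (auto simp: record_in_def)

lemma record_in_decreasing:
  assumes "record_in G M x" "record_in G M y" "snd x < snd y"
  shows "norm (fst y) < norm (fst x)"
  using assms by (intro record_in_less) (auto simp: record_in_def)

text \<open>A period \<open>y\<close> would let the height of the record \<open>x\<close> be reduced without changing its norm.\<close>

lemma record_in_no_period:
  assumes "record_in G M x" "y \<in> G" "0 < snd y" "snd y \<le> 2 * M"
  shows "fst y \<noteq> 0"
proof
  assume "fst y = 0"
  then have "norm (fst x) < norm (fst (x - y))"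
    using assms diff by (intro record_in_less) (auto simp: record_in_def)
  then show False using \<open>fst y = 0\<close> by simp
qed

lemma record_in_not_double:
  assumes "record_in G M x" "w \<in> G"
  shows "x \<noteq> 2 *\<^sub>R w"
proof
  assume eq: "x = 2 *\<^sub>R w"
  have "norm (fst x) < norm (fst w)"
    using assms eq by (intro record_in_less) (auto simp: record_in_def)
  then show False using eq by simp
qed

text \<open>Half the difference has height below \<open>snd x\<close> in absolute value, so it would
  be longer than \<open>x\<close>. By the triangle inequality it is at most the mean of the two
  norms, hence shorter than the longer vector \<open>x\<close>.\<close>

lemma record_in_incongruent:
  assumes x: "record_in G M x" and y: "record_in G M y" and less: "snd x < snd y" and w: "w \<in> G"
  shows "x - y \<noteq> 2 *\<^sub>R w"
proof
  assume eq: "x - y = 2 *\<^sub>R w"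
  have f: "fst x - fst y = 2 *\<^sub>R fst w" and s: "snd x - snd y = 2 * snd w"
    using arg_cong[OF eq, of fst] arg_cong[OF eq, of snd] by auto
  have dec: "norm (fst y) < norm (fst x)" using record_in_decreasing[OF x y less] .
  then have "fst w \<noteq> 0" using f by auto
  then have "norm (fst x) < norm (fst w)"
    using x y w s less by (intro record_in_less) (auto simp: record_in_def)
  moreover have "2 * norm (fst w) = norm (fst x - fst y)" using f by simp
  ultimately show False
    using dec norm_triangle_ineq4[of "fst x" "fst y"] by linarith
qed

lemma record_in_sum_free:
  assumes a: "record_in G M a" and b: "record_in G M b" and c: "record_in G M c"
    and ab: "snd a < snd b" and bc: "snd b < snd c" and w: "w \<in> G"
  shows "a + b + c \<noteq> 2 *\<^sub>R w"
proof
  assume eq: "a + b + c = 2 *\<^sub>R w"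
  have f: "fst a + fst b + fst c = 2 *\<^sub>R fst w" and s: "snd a + snd b + snd c = 2 * snd w"
    using arg_cong[OF eq, of fst] arg_cong[OF eq, of snd] by auto
  have bounds: "M < snd a" "snd c \<le> 2 * M" and G: "a \<in> G" "b \<in> G" "c \<in> G"
    using a b c by (auto simp: record_in_def)
  \<comment> \<open>The vectors \<open>w - c\<close>, \<open>w - b\<close>, \<open>w - a\<close> are
    the halves of the three sign changes. Their heights are positive; the first two lie below
    \<open>snd a\<close>, the third below \<open>snd c\<close>.\<close>
  have "fst (w - c) \<noteq> 0"
    using s bounds ab bc w G by (intro record_in_no_period[OF a] diff) auto
  then have 1: "norm (fst a) < norm (fst (w - c))"
    using s bounds ab bc w G by (intro record_in_less[OF a] diff) auto
  have "fst (w - b) \<noteq> 0"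
    using s bounds ab bc w G by (intro record_in_no_period[OF a] diff) auto
  then have 2: "norm (fst a) < norm (fst (w - b))"
    using s bounds ab bc w G by (intro record_in_less[OF a] diff) auto
  have "fst (w - a) \<noteq> 0"
    using s bounds ab bc w G by (intro record_in_no_period[OF a] diff) auto
  then have 3: "norm (fst c) < norm (fst (w - a))"
    using s bounds ab bc w G by (intro record_in_less[OF c] diff) auto
  have "fst a + fst b - fst c = 2 *\<^sub>R fst (w - c)" "fst a - fst b + fst c = 2 *\<^sub>R fst (w - b)"
    "fst b + fst c - fst a = 2 *\<^sub>R fst (w - a)"
    using f by (simp_all add: algebra_simps scaleR_2)
  then have "4 * (norm (fst (w - c)))\<^sup>2 + 4 * (norm (fst (w - b)))\<^sup>2 + 4 * (norm (fst (w - a)))\<^sup>2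
      + (norm (fst a + fst b + fst c))\<^sup>2
    = 4 * ((norm (fst a))\<^sup>2 + (norm (fst b))\<^sup>2 + (norm (fst c))\<^sup>2)"
    using sum_of_sign_changes_norm[of "fst a" "fst b" "fst c"] by (simp add: power_mult_distrib)
  moreover have "(norm (fst a))\<^sup>2 < (norm (fst (w - c)))\<^sup>2" "(norm (fst a))\<^sup>2 < (norm (fst (w - b)))\<^sup>2"
    "(norm (fst c))\<^sup>2 < (norm (fst (w - a)))\<^sup>2"
    using 1 2 3 by (auto intro: power_strict_mono)
  moreover have "(norm (fst b))\<^sup>2 < (norm (fst a))\<^sup>2"
    using record_in_decreasing[OF a b ab] by (intro power_strict_mono) auto
  moreover have "0 \<le> (norm (fst a + fst b + fst c))\<^sup>2" by simp
  \<comment> \<open>The left side is at least \<open>4 * (X + Y + Z)\<close>, which exceeds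
    \<open>4 * (2 * A + C)\<close> and so \<open>4 * (A + B + C)\<close>.\<close>
  moreover have False
    if "4 * X + 4 * Y + 4 * Z + V = 4 * (A + B + C)" "A < X" "A < Y" "C < Z" "B < A" "0 \<le> V"
    for A B C X Y Z V :: real
    using that by (simp add: distrib_left)
  ultimately show False by blast
qed

text \<open>The product with the line has dimension one more than \<open>'a\<close>; the extra
  factor 2 cancels against the doubling of \<open>S\<close> by its translate.\<close>

lemma card_records_le:
  assumes S: "\<And>x. x \<in> S \<Longrightarrow> record_in G M x" "finite S" and inj: "inj_on snd S"
  shows "card S \<le> 2 ^ DIM('a)"
proof -
  have "2 * card S \<le> 2 ^ DIM('a \<times> real)"
  proof (rule card_sum_free_mod_2)
    show "S \<subseteq> G" using S by (auto simp: record_in_def)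
    show "a \<noteq> 2 *\<^sub>R w" if "a \<in> S" "w \<in> G" for a w
      using that S record_in_not_double by blast
    show "a - b \<noteq> 2 *\<^sub>R w" if *: "a \<in> S" "b \<in> S" "a \<noteq> b" "w \<in> G" for a b w
    proof (cases "snd a < snd b")
      case True
      then show ?thesis using * S record_in_incongruent by blast
    next
      case False
      then have "snd b < snd a" using * inj by (force simp: inj_on_def)
      then have "b - a \<noteq> 2 *\<^sub>R (- w)"
        using * S by (intro record_in_incongruent[where M = M] uminus) auto
      then show ?thesis by (metis minus_diff_eq scaleR_minus_right)
    qed
    show "a + b + c \<noteq> 2 *\<^sub>R w"
      if *: "a \<in> S" "b \<in> S" "c \<in> S" "a \<noteq> b" "a \<noteq> c" "b \<noteq> c" "w \<in> G" for a b c w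
    proof -
      have ne: "snd a \<noteq> snd b" "snd a \<noteq> snd c" "snd b \<noteq> snd c"
        using * inj by (auto simp: inj_on_def)
      have sf: "x + y + z \<noteq> 2 *\<^sub>R w" if "x \<in> S" "y \<in> S" "z \<in> S" "snd x < snd y" "snd y < snd z"
        for x y z
        using that S \<open>w \<in> G\<close> record_in_sum_free by blast
      consider "snd a < snd b" "snd b < snd c" | "snd a < snd c" "snd c < snd b"
        | "snd b < snd a" "snd a < snd c" | "snd b < snd c" "snd c < snd a"
        | "snd c < snd a" "snd a < snd b" | "snd c < snd b" "snd b < snd a"
        using ne by linarith
      then show ?thesis
        using sf[of a b c] sf[of a c b] sf[of b a c] sf[of b c a] sf[of c a b] sf[of c b a] *
        by cases (auto simp: add_ac)
    qed
  qed (use S in auto)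
  then show ?thesis by simp
qed

section \<open>The least norm as a function of the height bound\<close>

definition height_norms :: "int \<Rightarrow> real set" where
  "height_norms M = {norm (fst x) | x. x \<in> G \<and> fst x \<noteq> 0 \<and> \<bar>snd x\<bar> \<le> of_int M}"

definition min_norm :: "int \<Rightarrow> real" where
  "min_norm M = (LEAST r. r \<in> height_norms M)"

text \<open>\<open>LEAST\<close> on the reals is meaningful only for an attained minimum. Bounding
  both norm and height bounds the pair, so only finitely many values lie below a given one.\<close>

lemma min_norm_least:
  assumes "height_norms M \<noteq> {}"
  shows "min_norm M \<in> height_norms M" "r \<in> height_norms M \<Longrightarrow> min_norm M \<le> r"
proof -
  obtain r0 where r0: "r0 \<in> height_norms M" using assms by blast
  let ?F = "height_norms M \<inter> {..r0}"
  have "?F \<subseteq> (\<lambda>x. norm (fst x)) ` {x \<in> G. norm x \<le> r0 + of_int M}"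
  proof
    fix r assume "r \<in> ?F"
    then obtain x where x: "x \<in> G" "norm (fst x) = r" "r \<le> r0" "\<bar>snd x\<bar> \<le> of_int M"
      by (auto simp: height_norms_def)
    then have "norm x \<le> r0 + of_int M"
      using norm_Pair_le[of "fst x" "snd x"] by simp
    then show "r \<in> (\<lambda>x. norm (fst x)) ` {x \<in> G. norm x \<le> r0 + of_int M}"
      using x by auto
  qed
  then have fin: "finite ?F"
    using finite_subset finite_bounded by blast
  have mem: "Min ?F \<in> ?F" using fin r0 by (intro Min_in) auto
  have le: "Min ?F \<le> r" if "r \<in> height_norms M" for r
  proof (cases "r \<le> r0")
    case True
    then show ?thesis using that fin by (intro Min_le) auto
  next
    case False
    then show ?thesis using mem by auto
  qed
  have "min_norm M = Min ?F"
    unfolding min_norm_def using mem le by (intro Least_equality) auto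
  then show "min_norm M \<in> height_norms M" "r \<in> height_norms M \<Longrightarrow> min_norm M \<le> r"
    using mem le by auto
qed

text \<open>A vector attaining the new minimum cannot have height below \<open>k\<close> in absolute
  value, since \<open>min_norm (k - 1)\<close> is larger. Integrality of heights turns
  \<open>< k\<close> into \<open><= k - 1\<close>.\<close>

lemma record_at_drop:
  assumes int: "\<And>x. x \<in> G \<Longrightarrow> snd x \<in> \<int>" and nonempty: "\<And>j. 0 \<le> j \<Longrightarrow> height_norms j \<noteq> {}"
    and k: "0 \<le> M" "M < k" "k \<le> 2 * M" and drop: "min_norm k < min_norm (k - 1)"
  obtains x where "record_in G (of_int M) x" "snd x = of_int k"
proof -
  have le: "min_norm (k - 1) \<le> norm (fst y)" if y: "y \<in> G" "fst y \<noteq> 0" "\<bar>snd y\<bar> < of_int k" for y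
  proof -
    obtain j where j: "snd y = of_int j" using int[OF y(1)] by (elim Ints_cases)
    then have "\<bar>j\<bar> \<le> k - 1" using y(3) by (simp flip: of_int_abs)
    then have "\<bar>snd y\<bar> \<le> of_int (k - 1)" unfolding j of_int_abs[symmetric] of_int_le_iff .
    then have "norm (fst y) \<in> height_norms (k - 1)"
      using y(1,2) unfolding height_norms_def by blast
    then show ?thesis using min_norm_least(2) by blast
  qed
  have "min_norm k \<in> height_norms k" using k nonempty by (intro min_norm_least) auto
  then obtain x where x: "x \<in> G" "fst x \<noteq> 0" "\<bar>snd x\<bar> \<le> of_int k" "min_norm k = norm (fst x)"
    by (auto simp: height_norms_def)
  then have top: "\<bar>snd x\<bar> = of_int k" using le[of x] drop by linarith
  \<comment> \<open>Negation turns height \<open>-k\<close> into \<open>k\<close> and keeps the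
    norm.\<close>
  define x' where "x' = (if snd x < 0 then - x else x)"
  have x': "x' \<in> G" "fst x' \<noteq> 0" "snd x' = of_int k" "norm (fst x') = min_norm k"
    using x top uminus by (auto simp: x'_def)
  moreover have "real_of_int k \<le> 2 * of_int M" using k by linarith
  moreover have "norm (fst x') < norm (fst y)"
    if "y \<in> G" "fst y \<noteq> 0" "\<bar>snd y\<bar> < snd x'" for y
    using le[of y] that x' drop by linarith
  ultimately have "record_in G (of_int M) x'"
    using k x' unfolding record_in_def by simp
  then show ?thesis using x' that by blast
qed

text \<open>Along the window the value changes only at drops, and each drop yields a record of its
  own height. The extra 1 is the starting value \<open>min_norm M\<close>.\<close>

lemma card_min_norm_image_le:
  assumes int: "\<And>x. x \<in> G \<Longrightarrow> snd x \<in> \<int>" and nonempty: "\<And>j. 0 \<le> j \<Longrightarrow> height_norms j \<noteq> {}"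
    and "0 \<le> M"
  shows "card (min_norm ` {M..2 * M}) \<le> 2 ^ DIM('a) + 1"
proof -
  define K where "K = {k \<in> {M<..2 * M}. min_norm k < min_norm (k - 1)}"
  have "finite K" by (rule finite_subset[of _ "{M<..2 * M}"]) (auto simp: K_def)
  have "\<forall>k\<in>K. \<exists>x. record_in G (of_int M) x \<and> snd x = of_int k"
  proof
    fix k assume "k \<in> K"
    then have "M < k" "k \<le> 2 * M" "min_norm k < min_norm (k - 1)" by (simp_all add: K_def)
    from record_at_drop[OF int nonempty \<open>0 \<le> M\<close> this]
    show "\<exists>x. record_in G (of_int M) x \<and> snd x = of_int k" by blast
  qed
  from bchoice[OF this] obtain X where X: "\<And>k. k \<in> K \<Longrightarrow> record_in G (of_int M) (X k)"
    "\<And>k. k \<in> K \<Longrightarrow> snd (X k) = of_int k" by blast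
  have "card (X ` K) \<le> 2 ^ DIM('a)"
    using X \<open>finite K\<close> by (intro card_records_le[of _ "of_int M"]) (auto simp: inj_on_def)
  moreover have "inj_on X K" using X(2) by (intro inj_onI) (metis of_int_eq_iff)
  ultimately have card_K: "card K \<le> 2 ^ DIM('a)" by (simp add: card_image)
  have step: "min_norm k \<in> insert (min_norm M) (min_norm ` K)" if "M \<le> k" "k \<le> 2 * M" for k
    using that
  proof (induction k rule: int_ge_induct)
    case (step k)
    show ?case
    proof (cases "k + 1 \<in> K")
      case False
      \<comment> \<open>A larger height bound only adds candidates, so the absence of a drop forces
        equality.\<close>
      have "min_norm (k + 1) \<le> min_norm k"
      proof (rule min_norm_least)
        have "height_norms k \<noteq> {}" using step.hyps \<open>0 \<le> M\<close> by (intro nonempty) simp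
        then have "min_norm k \<in> height_norms k" by (rule min_norm_least)
        moreover have "height_norms k \<subseteq> height_norms (k + 1)"
        proof
          fix r assume "r \<in> height_norms k"
          then obtain x where "x \<in> G" "fst x \<noteq> 0" "\<bar>snd x\<bar> \<le> of_int k" "r = norm (fst x)"
            unfolding height_norms_def by blast
          moreover from this have "\<bar>snd x\<bar> \<le> of_int (k + 1)" by simp
          ultimately show "r \<in> height_norms (k + 1)" unfolding height_norms_def by blast
        qed
        ultimately show "min_norm k \<in> height_norms (k + 1)" by blast
        then show "height_norms (k + 1) \<noteq> {}" by blast
      qed
      then have "min_norm (k + 1) = min_norm k" using False step.hyps step.prems by (simp add: K_def)
      then show ?thesis using step.IH step.prems by simp
    qed simp
  qed simp
  have "card (min_norm ` {M..2 * M}) \<le> card (insert (min_norm M) (min_norm ` K))"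
  proof (rule card_mono)
    show "min_norm ` {M..2 * M} \<subseteq> insert (min_norm M) (min_norm ` K)"
      by (intro image_subsetI step) simp_all
  qed (simp add: \<open>finite K\<close>)
  also have "\<dots> \<le> card (min_norm ` K) + 1"
    using \<open>finite K\<close> by (simp add: card_insert_if)
  also have "\<dots> \<le> card K + 1" using \<open>finite K\<close> by (simp add: card_image_le)
  finally show ?thesis using card_K by simp
qed

end

section \<open>The lattice problem as a question about heights\<close>

definition kronecker_group :: "'a::real_vector set \<Rightarrow> 'a \<Rightarrow> ('a \<times> real) set" where
  "kronecker_group L \<alpha> = {(of_int k *\<^sub>R \<alpha> + l, of_int k) | k l. l \<in> L}"

lemma full_rank_lattice_separated:
  assumes "full_rank_lattice L"
  obtains e where "0 < e" "\<And>l. l \<in> L \<Longrightarrow> l \<noteq> 0 \<Longrightarrow> e \<le> norm l"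
proof -
  have "0 isolated_in L" using assms by (auto simp: full_rank_lattice_def discrete_def)
  then obtain e where "e > 0" "\<And>l. l \<in> L \<Longrightarrow> dist 0 l < e \<Longrightarrow> l = 0"
    unfolding isolated_in_dist_Ex_iff by blast
  then show ?thesis using that[of e] by force
qed

text \<open>Multiples of \<open>\<alpha>\<close> may come arbitrarily close to \<open>L\<close>, but
  the second coordinate keeps them apart: nonzero height gives norm at least 1, and height zero
  leaves a lattice vector.\<close>

lemma kronecker_group_separated:
  assumes L: "full_rank_lattice L"
  obtains e where "separated_product_group (kronecker_group L \<alpha>) e"
proof -
  obtain e where e: "0 < e" "\<And>l. l \<in> L \<Longrightarrow> l \<noteq> 0 \<Longrightarrow> e \<le> norm l"
    using full_rank_lattice_separated[OF L] by blast
  have sub: "0 \<in> L" "\<And>x y. x \<in> L \<Longrightarrow> y \<in> L \<Longrightarrow> x + y \<in> L" "\<And>x. x \<in> L \<Longrightarrow> - x \<in> L"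
    using L by (auto simp: full_rank_lattice_def)
  have "separated_product_group (kronecker_group L \<alpha>) (min e 1)"
  proof (unfold_locales, goal_cases)
    case 1
    have "(0, 0) = (of_int 0 *\<^sub>R \<alpha> + 0, of_int 0)" by simp
    then show ?case using sub unfolding kronecker_group_def zero_prod_def by blast
  next
    case (2 x y)
    then obtain k l k' l' where "l \<in> L" "l' \<in> L"
      "x = (of_int k *\<^sub>R \<alpha> + l, of_int k)" "y = (of_int k' *\<^sub>R \<alpha> + l', of_int k')"
      by (auto simp: kronecker_group_def)
    then have "x + y = (of_int (k + k') *\<^sub>R \<alpha> + (l + l'), of_int (k + k'))" "l + l' \<in> L"
      using sub by (simp_all add: algebra_simps)
    then show ?case unfolding kronecker_group_def by blast
  next
    case (3 x)
    then obtain k l where "l \<in> L" "x = (of_int k *\<^sub>R \<alpha> + l, of_int k)"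
      by (auto simp: kronecker_group_def)
    then have "- x = (of_int (- k) *\<^sub>R \<alpha> + (- l), of_int (- k))" "- l \<in> L"
      using sub by simp_all
    then show ?case unfolding kronecker_group_def by blast
  next
    case 4
    then show ?case using e by simp
  next
    case (5 x)
    then obtain k l where x: "l \<in> L" "x = (of_int k *\<^sub>R \<alpha> + l, of_int k)"
      by (auto simp: kronecker_group_def)
    show ?case
    proof (cases "k = 0")
      case True
      then show ?thesis using e x 5 by (auto simp: norm_Pair zero_prod_def min_le_iff_disj)
    next
      case False
      then have "1 \<le> \<bar>of_int k :: real\<bar>" by (simp flip: of_int_abs)
      also have "\<dots> \<le> norm x" using norm_snd_le[of "of_int k :: real" "of_int k *\<^sub>R \<alpha> + l"] x by simp
      finally show ?thesis by simp
    qed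
  qed
  then show ?thesis using that by blast
qed

theorem theorem1p1:
  fixes L :: "'a::euclidean_space set" and \<alpha> :: 'a and N :: int
  assumes "full_rank_lattice L" and "N \<ge> 2"
  shows "gap_count \<alpha> L N \<le> 2 ^ DIM('a) + 1"
proof -
  define G where "G = kronecker_group L \<alpha>"
  obtain e where "separated_product_group G e"
    using kronecker_group_separated[OF assms(1)] unfolding G_def by blast
  then interpret separated_product_group G e .
  have mem: "x \<in> G \<longleftrightarrow> (\<exists>k. \<exists>l\<in>L. x = (of_int k *\<^sub>R \<alpha> + l, of_int k))" for x
    by (auto simp: G_def kronecker_group_def)
  have "\<not> L \<subseteq> {0}"
  proof
    assume "L \<subseteq> {0}"
    then have "span L \<subseteq> {0}" by (metis span_mono span_0 span_empty span_insert_0)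
    moreover obtain b :: 'a where "b \<in> Basis" using nonempty_Basis by blast
    ultimately show False using assms(1) nonzero_Basis by (auto simp: full_rank_lattice_def)
  qed
  then obtain l0 where "l0 \<in> L" "l0 \<noteq> 0" by blast
  \<comment> \<open>This is the choice \<open>m = n\<close>: a lattice vector at height 0 is
    available under every nonnegative bound.\<close>
  then have "(l0, 0) \<in> G" unfolding mem by (intro exI[of _ 0] bexI[of _ l0]) auto
  then have nonempty: "height_norms j \<noteq> {}" if "0 \<le> j" for j
    using that \<open>l0 \<noteq> 0\<close> by (force simp: height_norms_def)
  have delta: "delta \<alpha> L N n = min_norm (max (n - 1) (N - n))" if n: "1 \<le> n" "n \<le> N" for n
  proof -
    have "{norm (of_int (m - n) *\<^sub>R \<alpha> + l) | m l.
        1 \<le> m \<and> m \<le> N \<and> l \<in> L \<and> of_int (m - n) *\<^sub>R \<alpha> + l \<noteq> 0} = height_norms (max (n - 1) (N - n))"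
      (is "?A = ?B")
    proof (intro equalityI subsetI)
      fix r assume "r \<in> ?A"
      then obtain m l where m: "1 \<le> m" "m \<le> N" "l \<in> L" "of_int (m - n) *\<^sub>R \<alpha> + l \<noteq> 0"
        "r = norm (of_int (m - n) *\<^sub>R \<alpha> + l)" by blast
      have "(of_int (m - n) *\<^sub>R \<alpha> + l, of_int (m - n)) \<in> G" using m mem by blast
      moreover have "\<bar>of_int (m - n) :: real\<bar> \<le> of_int (max (n - 1) (N - n))"
        using m unfolding of_int_abs[symmetric] of_int_le_iff by linarith
      ultimately show "r \<in> ?B" using m unfolding height_norms_def by force
    next
      fix r assume "r \<in> ?B"
      then obtain x where x: "x \<in> G" "fst x \<noteq> 0" "\<bar>snd x\<bar> \<le> of_int (max (n - 1) (N - n))"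
        "r = norm (fst x)" unfolding height_norms_def by blast
      have main: "norm (fst y) \<in> ?A"
        if y: "y \<in> G" "fst y \<noteq> 0" "of_int (1 - n) \<le> snd y" "snd y \<le> of_int (N - n)" for y
      proof -
        obtain k l where kl: "l \<in> L" "y = (of_int k *\<^sub>R \<alpha> + l, of_int k)" using y mem by blast
        then have "1 - n \<le> k" "k \<le> N - n" using y by (simp_all only: snd_conv of_int_le_iff)
        then show ?thesis using y kl
          by (intro CollectI exI[of _ "k + n"] exI[of _ l]) auto
      qed
      \<comment> \<open>The interval from \<open>1 - n\<close> to \<open>N - n\<close> contains 0,
        and one of its ends has the maximum as absolute value. Choosing the sign towards that end
        puts \<open>x\<close> or \<open>- x\<close> inside.\<close>
      have "of_int (1 - n) \<le> snd x \<and> snd x \<le> of_int (N - n) \<or>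
          of_int (1 - n) \<le> snd (- x) \<and> snd (- x) \<le> of_int (N - n)"
        using x(3) n by (auto simp: max_def split: if_splits)
      then show "r \<in> ?A" using main[of x] main[of "- x"] x uminus by auto
    qed
    then show ?thesis by (simp add: delta_def min_norm_def)
  qed
  have "{delta \<alpha> L N n | n. 1 \<le> n \<and> n \<le> N} \<subseteq> min_norm ` {N div 2..2 * (N div 2)}"
  proof clarify
    fix n assume n: "1 \<le> n" "n \<le> N"
    \<comment> \<open>The two numbers add up to \<open>N - 1\<close>, so the larger is at least
      \<open>N div 2\<close>; it is at most \<open>N - 1\<close>, which never exceeds
      \<open>2 * (N div 2)\<close>, whatever the parity of \<open>N\<close>.\<close>
    then have "max (n - 1) (N - n) \<in> {N div 2..2 * (N div 2)}" by auto
    then show "delta \<alpha> L N n \<in> min_norm ` {N div 2..2 * (N div 2)}" using delta n by blast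
  qed
  then have "gap_count \<alpha> L N \<le> card (min_norm ` {N div 2..2 * (N div 2)})"
    unfolding gap_count_def by (intro card_mono) auto
  also have "\<dots> \<le> 2 ^ DIM('a) + 1"
    using assms(2) nonempty by (intro card_min_norm_image_le) (auto simp: mem)
  finally show ?thesis .
qed

end
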